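(* Let $\mathcal{T}\subset I\times J\times I\times J$ be a finite set of Wang tiles having horizontal and vertical stripes, with associated partition $\mathcal{T}=\mathcal{T}_{00}\cup\mathcal{T}_{01}\cup\mathcal{T}_{10}\cup\mathcal{T}_{11}$. Suppose that $\mathcal{T}$ determines the quadrilateral $ABDC$ for some $A,B,C,D\in\mathbb{R}^2$. If there exists a doubly-periodic valid configuration $w:\mathbb{Z}^2\to\mathcal{T}$ in which vertical stripes (tiles in $\mathcal{T}_{01}\cup\mathcal{T}_{11}$) have density $\alpha$ and horizontal stripes (tiles in $\mathcal{T}_{10}\cup\mathcal{T}_{11}$) have density $\beta$, then $$\begin{pmatrix}0\\0\end{pmatrix}=(1-\alpha)\big((1-\beta)A+\beta B\big)+\alpha\big((1-\beta)C+\beta D\big).$$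
   Context: Wang tiles. Let $I$ (vertical colors) and $J$ (horizontal colors) be finite sets. A Wang tile is a tuple $\tau=(a,b,c,d)\in I\times J\times I\times J$, where $a,b,c,d$ are the labels of the right (east), top (north), left (west) and bottom (south) edges of a unit square. For a finite set $\mathcal{T}$ of Wang tiles, a configuration $w:\mathbb{Z}^2\to\mathcal{T}$ is valid if for all $n\in\mathbb{Z}^2$ the east label of $w_n$ equals the west label of $w_{n+(1,0)}$ and the north label of $w_n$ equals the south label of $w_{n+(0,1)}$. A period of $w$ is $p\in\mathbb{Z}^2\setminus\{0\}$ with $w_{n+p}=w_n$ for all $n$; $w$ is doubly-periodic if it has two linearly independent periods. Stripes. $\mathcal{T}$ has horizontal and vertical stripes if there are partitions $I=I_0\sqcup I_1$ and $J=J_0\sqcup J_1$ such that every $(a,b,c,d)\in\mathcal{T}$ has $a,c$ in the same part of $I$ and $b,d$ in the same part of $J$. Then $\mathcal{T}_{xy}=\mathcal{T}\cap(I_x\times J_y\times I_x\times J_y)$ for $x,y\in\{0,1\}$ ($x=1$: horizontal stripe present; $y=1$: vertical stripe present). Quadrilateral. $\mathcal{T}$ determines the quadrilateral $ABDC$ ($A,B,C,D\in\mathbb{R}^2$, possibly degenerate) if there are maps $v:I\to\mathbb{R}^2$ and $h:J\to\mathbb{R}^2$ such that for every $\tau=(a,b,c,d)\in\mathcal{T}$, the vector $v(a)+h(b)-v(c)-h(d)$ equals $A$ if $\tau\in\mathcal{T}_{00}$, $B$ if $\tau\in\mathcal{T}_{10}$, $C$ if $\tau\in\mathcal{T}_{01}$,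 and $D$ if $\tau\in\mathcal{T}_{11}$. Density. The density of $\mathcal{S}\subset\mathcal{T}$ in $w$ is $\lim_{K\to\infty}\#\{n\in\mathbb{Z}^2\cap[-K,K]^2: w_n\in\mathcal{S}\}/(2K+1)^2$ (for a doubly-periodic $w$ it is the proportion of such positions in a fundamental domain). *)

theory Defs
  imports "HOL-Analysis.Analysis"
begin

text \<open>A tile \<open>(a, b, c, d)\<close> lists its edge labels in the order east, north, west, south.\<close>

type_synonym ('i, 'j) tile = "'i \<times> 'j \<times> 'i \<times> 'j"

fun east :: "('i, 'j) tile \<Rightarrow> 'i" where "east (a, b, c, d) = a"
fun north :: "('i, 'j) tile \<Rightarrow> 'j" where "north (a, b, c, d) = b"
fun west :: "('i, 'j) tile \<Rightarrow> 'i" where "west (a, b, c, d) = c"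
fun south :: "('i, 'j) tile \<Rightarrow> 'j" where "south (a, b, c, d) = d"

definition wang_tiles :: "'i set \<Rightarrow> 'j set \<Rightarrow> ('i, 'j) tile set \<Rightarrow> bool" where
  "wang_tiles I J T \<longleftrightarrow> finite I \<and> finite J \<and> finite T \<and> T \<subseteq> I \<times> J \<times> I \<times> J"

definition valid_configuration ::
    "('i, 'j) tile set \<Rightarrow> (int \<times> int \<Rightarrow> ('i, 'j) tile) \<Rightarrow> bool" where
  "valid_configuration T w \<longleftrightarrow>
     (\<forall>n. w n \<in> T) \<and>
     (\<forall>n. east (w n) = west (w (n + (1, 0))) \<and> north (w n) = south (w (n + (0, 1))))"

definition is_period :: "(int \<times> int \<Rightarrow> 'a) \<Rightarrow> int \<times> int \<Rightarrow> bool" where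
  "is_period w p \<longleftrightarrow> p \<noteq> 0 \<and> (\<forall>n. w (n + p) = w n)"

definition lattice_vec :: "int \<times> int \<Rightarrow> real \<times> real" where
  "lattice_vec p = (real_of_int (fst p), real_of_int (snd p))"

text \<open>\<^const>\<open>independent\<close> speaks about sets, so \<open>p \<noteq> q\<close> has to be required separately.\<close>

definition doubly_periodic :: "(int \<times> int \<Rightarrow> 'a) \<Rightarrow> bool" where
  "doubly_periodic w \<longleftrightarrow>
     (\<exists>p q. is_period w p \<and> is_period w q \<and> p \<noteq> q \<and>
        independent {lattice_vec p, lattice_vec q})"

text \<open>The parts of the two partitions are allowed to be empty.\<close>

definition has_stripes ::
    "'i set \<Rightarrow> 'j set \<Rightarrow> 'i set \<Rightarrow> 'i set \<Rightarrow> 'j set \<Rightarrow> 'j set \<Rightarrow> ('i, 'j) tile set \<Rightarrow> bool" where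
  "has_stripes I J I0 I1 J0 J1 T \<longleftrightarrow>
     I = I0 \<union> I1 \<and> I0 \<inter> I1 = {} \<and> J = J0 \<union> J1 \<and> J0 \<inter> J1 = {} \<and>
     (\<forall>(a, b, c, d) \<in> T.
        (a \<in> I0 \<and> c \<in> I0 \<or> a \<in> I1 \<and> c \<in> I1) \<and>
        (b \<in> J0 \<and> d \<in> J0 \<or> b \<in> J1 \<and> d \<in> J1))"

definition tile_class ::
    "('i, 'j) tile set \<Rightarrow> 'i set \<Rightarrow> 'j set \<Rightarrow> ('i, 'j) tile set" where
  "tile_class T Ix Jy = T \<inter> (Ix \<times> Jy \<times> Ix \<times> Jy)"

text \<open>
  The points are taken in the cyclic order \<open>A, B, D, C\<close> of the quadrilateral's name: \<open>B\<close> belongs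
  to the tiles with only a horizontal stripe and \<open>C\<close> to those with only a vertical one.
\<close>

definition determines_quadrilateral ::
    "'i set \<Rightarrow> 'i set \<Rightarrow> 'j set \<Rightarrow> 'j set \<Rightarrow> ('i, 'j) tile set \<Rightarrow>
     real ^ 2 \<Rightarrow> real ^ 2 \<Rightarrow> real ^ 2 \<Rightarrow> real ^ 2 \<Rightarrow> bool" where
  "determines_quadrilateral I0 I1 J0 J1 T A B D C \<longleftrightarrow>
     (\<exists>(v :: 'i \<Rightarrow> real ^ 2) (h :: 'j \<Rightarrow> real ^ 2). \<forall>(a, b, c, d) \<in> T.
        ((a, b, c, d) \<in> tile_class T I0 J0 \<longrightarrow> v a + h b - v c - h d = A) \<and>
        ((a, b, c, d) \<in> tile_class T I1 J0 \<longrightarrow> v a + h b - v c - h d = B) \<and>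
        ((a, b, c, d) \<in> tile_class T I0 J1 \<longrightarrow> v a + h b - v c - h d = C) \<and>
        ((a, b, c, d) \<in> tile_class T I1 J1 \<longrightarrow> v a + h b - v c - h d = D))"

definition has_density :: "(int \<times> int \<Rightarrow> 'a) \<Rightarrow> 'a set \<Rightarrow> real \<Rightarrow> bool" where
  "has_density w S \<delta> \<longleftrightarrow>
     (\<lambda>K :: nat. real (card {n \<in> {- int K..int K} \<times> {- int K..int K}. w n \<in> S})
        / (2 * real K + 1) ^ 2) \<longlonglongrightarrow> \<delta>"

end

theory Submission
  imports Defs "HOL-Real_Asymp.Real_Asymp"
begin

text \<open>
  Being in a horizontal stripe depends only on the row and being in a vertical stripe only on the
  column, so the class of a tile is determined by two independent coordinates. Summing
  \<open>v a + h b - v c - h d\<close> over the box \<open>[-K, K]\<^sup>2\<close> in two ways gives the claim: on the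
  one hand the sum telescopes to a boundary term of size \<open>O(K)\<close>; on the other hand it factors
  through the proportions of striped rows and columns in \<open>[-K, K]\<close>, which converge to
  \<open>\<beta>\<close> and \<open>\<alpha>\<close>. Divide by \<open>(2K + 1)\<^sup>2\<close> and let \<open>K\<close> tend to infinity.
\<close>

lemma sum_telescope_symmetric:
  fixes g :: "int \<Rightarrow> 'a::ab_group_add"
  shows "(\<Sum>x\<in>{- int K..int K}. g (x + 1) - g x) = g (int K + 1) - g (- int K)"
proof (induction K)
  case (Suc K)
  \<comment> \<open>The interval grows at both ends, so the induction step adds two differences, one
    at each end.\<close>
  have "{- int (Suc K)..int (Suc K)}
      = insert (- int (Suc K)) (insert (int (Suc K)) {- int K..int K})"
    by auto
  with Suc show ?case
    by (simp add: algebra_simps)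
qed simp

lemma sum_If_scaleR:
  fixes p q :: "'a::real_vector"
  assumes "finite X"
  shows "(\<Sum>x\<in>X. if P x then p else q)
    = real (card {x \<in> X. P x}) *\<^sub>R p + (real (card X) - real (card {x \<in> X. P x})) *\<^sub>R q"
proof -
  have "X \<inter> - {x. P x} = X - {x \<in> X. P x}" "X \<inter> {x. P x} = {x \<in> X. P x}"
    by auto
  moreover have "card {x \<in> X. P x} \<le> card X"
    using assms by (simp add: card_mono)
  ultimately show ?thesis
    using assms by (simp add: sum.If_cases card_Diff_subset of_nat_diff sum_constant_scaleR)
qed

lemma shift_invariant_const:
  fixes f :: "int \<Rightarrow> 'a"
  assumes "\<And>x. f (x + 1) = f x"
  shows "f x = f 0"
proof (induction x rule: int_induct[where k = 0])
  case (step2 i)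
  then show ?case using assms[of "i - 1"] by simp
qed (simp_all add: assms)

text \<open>A discrete divergence theorem: \<open>f\<close> telescopes along each row and
  \<open>g\<close> along each column, leaving two boundary values per line. Hence the bound is
  linear in \<open>K\<close>, although the box has quadratically many points.\<close>

lemma norm_sum_discrete_divergence_le:
  fixes f g :: "int \<times> int \<Rightarrow> 'a::real_normed_vector"
  assumes f: "\<And>n. norm (f n) \<le> M" and g: "\<And>n. norm (g n) \<le> N"
  shows "norm (\<Sum>x\<in>{- int K..int K}. \<Sum>y\<in>{- int K..int K}.
      (f (x + 1, y) - f (x, y)) + (g (x, y + 1) - g (x, y))) \<le> (2 * real K + 1) * (2 * M + 2 * N)"
    (is "norm ?S \<le> _")
proof -
  let ?B = "{- int K..int K}"
  have "?S = (\<Sum>y\<in>?B. \<Sum>x\<in>?B. f (x + 1, y) - f (x, y))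
      + (\<Sum>x\<in>?B. \<Sum>y\<in>?B. g (x, y + 1) - g (x, y))"
    by (simp only: sum.distrib) (subst sum.swap, rule refl)
  also have "\<dots> = (\<Sum>y\<in>?B. f (int K + 1, y) - f (- int K, y))
      + (\<Sum>x\<in>?B. g (x, int K + 1) - g (x, - int K))"
    by (simp only: sum_telescope_symmetric[of "\<lambda>x. f (x, y)" for y]
        sum_telescope_symmetric[of "\<lambda>y. g (x, y)" for x])
  also have "norm \<dots> \<le> real (card ?B) * (M + M) + real (card ?B) * (N + N)"
    by (intro norm_triangle_mono sum_norm_bound norm_triangle_le_diff add_mono f g)
  finally show ?thesis
    by (simp add: algebra_simps)
qed

text \<open>Membership depends on the first coordinate alone, so the counted set is a product with a
  full side of length \<open>2 * K + 1\<close>, which cancels one factor of the area.\<close>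

lemma has_density_product:
  "has_density w S \<delta> \<longleftrightarrow>
    (\<lambda>K. real (card {x \<in> {- int K..int K}. P x}) / (2 * real K + 1)) \<longlonglongrightarrow> \<delta>"
  if "\<And>x y. w (x, y) \<in> S \<longleftrightarrow> P x"
proof -
  have "{n \<in> {- int K..int K} \<times> {- int K..int K}. w n \<in> S}
      = {x \<in> {- int K..int K}. P x} \<times> {- int K..int K}" for K
    using that by auto
  then show ?thesis
    by (simp add: has_density_def card_cartesian_product power2_eq_square add.commute)
qed

text \<open>The boxes are symmetric under reflection in the diagonal. This carries
  \<open>has_density_product\<close> over to sets whose membership depends on the row only.\<close>

lemma has_density_swap:
  "has_density (w \<circ> prod.swap) S \<delta> \<longleftrightarrow> has_density w S \<delta>"
proof -
  have "{n \<in> X \<times> X. (w \<circ> prod.swap) n \<in> S} = prod.swap ` {n \<in> X \<times> X. w n \<in> S}" for X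
    by force
  then show ?thesis
    by (simp add: has_density_def card_image)
qed

text \<open>A tile keeps the part of its label from west to east, and edge matching hands that label
  to the right neighbour; so the part is constant along a row. The same holds for south and north
  along a column.\<close>

lemma valid_stripes:
  assumes st: "has_stripes I J I0 I1 J0 J1 T" and w: "valid_configuration T w"
  obtains c r where
    "\<And>x y. w (x, y) \<in> tile_class T (if r y then I1 else I0) (if c x then J1 else J0)"
proof -
  have T: "w n \<in> T" for n
    using w unfolding valid_configuration_def by blast
  have row: "east (w (x, y)) = west (w (x + 1, y))"
    and col: "north (w (x, y)) = south (w (x, y + 1))" for x y
    using w by (force simp: valid_configuration_def)+
  \<comment> \<open>The two parts are disjoint and cover the labels of every tile, so membership in
    \<open>I1\<close> or \<open>J1\<close> alone records the part.\<close>
  have I: "(west t \<in> I1 \<longleftrightarrow> east t \<in> I1) \<and> (south t \<in> J1 \<longleftrightarrow> north t \<in> J1)"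
    and cls: "t \<in> tile_class T (if west t \<in> I1 then I1 else I0) (if south t \<in> J1 then J1 else J0)"
    if "t \<in> T" for t
    using st that unfolding has_stripes_def tile_class_def
    by (cases t; fastforce)+
  have r: "west (w (x, y)) \<in> I1 \<longleftrightarrow> west (w (0, y)) \<in> I1" for x y
    using I[OF T] row by (intro shift_invariant_const[of "\<lambda>x. west (w (x, y)) \<in> I1"]) metis
  have c: "south (w (x, y)) \<in> J1 \<longleftrightarrow> south (w (x, 0)) \<in> J1" for x y
    using I[OF T] col by (intro shift_invariant_const[of "\<lambda>y. south (w (x, y)) \<in> J1"]) metis
  have "w (x, y) \<in> tile_class T (if west (w (0, y)) \<in> I1 then I1 else I0)
      (if south (w (x, 0)) \<in> J1 then J1 else J0)" for x y
    using cls[OF T, of "(x, y)"] unfolding r[of x y] c[of x y] .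
  then show ?thesis
    by (rule that)
qed

theorem lemma3p2:
  fixes I I0 I1 :: "'i set" and J J0 J1 :: "'j set"
    and T :: "('i, 'j) tile set"
    and A B C D :: "real ^ 2"
    and w :: "int \<times> int \<Rightarrow> ('i, 'j) tile"
    and \<alpha> \<beta> :: real
  assumes "wang_tiles I J T"
    and "has_stripes I J I0 I1 J0 J1 T"
    and "determines_quadrilateral I0 I1 J0 J1 T A B D C"
    and "valid_configuration T w"
    and "doubly_periodic w"
    and "has_density w (tile_class T I0 J1 \<union> tile_class T I1 J1) \<alpha>"
    and "has_density w (tile_class T I1 J0 \<union> tile_class T I1 J1) \<beta>"
  shows "0 = (1 - \<alpha>) *\<^sub>R ((1 - \<beta>) *\<^sub>R A + \<beta> *\<^sub>R B) + \<alpha> *\<^sub>R ((1 - \<beta>) *\<^sub>R C + \<beta> *\<^sub>R D)"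
proof -
  obtain c r where
    cls: "w (x, y) \<in> tile_class T (if r y then I1 else I0) (if c x then J1 else J0)" for x y
    using valid_stripes[OF assms(2,4)] by metis
  have T: "w n \<in> T" for n
    using assms(4) unfolding valid_configuration_def by blast
  have disj: "I0 \<inter> I1 = {}" "J0 \<inter> J1 = {}"
    using assms(2) by (auto simp: has_stripes_def)
  let ?a = "\<lambda>K. real (card {x \<in> {- int K..int K}. c x})"
  let ?b = "\<lambda>K. real (card {y \<in> {- int K..int K}. r y})"
  let ?M = "\<lambda>K. 2 * real K + 1"
  \<comment> \<open>Disjointness of the parts keeps a tile from lying in two classes, so the union
    detects exactly the striped columns.\<close>
  have "w (x, y) \<in> tile_class T I0 J1 \<union> tile_class T I1 J1 \<longleftrightarrow> c x" for x y
    using cls[of x y] disj by (auto simp: tile_class_def split: if_splits)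
  then have \<alpha>: "(\<lambda>K. ?a K / ?M K) \<longlonglongrightarrow> \<alpha>"
    using assms(6) by (subst (asm) has_density_product[where P = c])
  have "(w \<circ> prod.swap) (y, x) \<in> tile_class T I1 J0 \<union> tile_class T I1 J1 \<longleftrightarrow> r y" for x y
    using cls[of x y] disj by (auto simp: tile_class_def split: if_splits)
  then have \<beta>: "(\<lambda>K. ?b K / ?M K) \<longlonglongrightarrow> \<beta>"
    using assms(7) unfolding has_density_swap[symmetric, of w]
    by (subst (asm) has_density_product[where P = r])
  obtain v :: "'i \<Rightarrow> real ^ 2" and h :: "'j \<Rightarrow> real ^ 2" where vh:
    "\<forall>(a, b, c, d) \<in> T.
        ((a, b, c, d) \<in> tile_class T I0 J0 \<longrightarrow> v a + h b - v c - h d = A) \<and>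
        ((a, b, c, d) \<in> tile_class T I1 J0 \<longrightarrow> v a + h b - v c - h d = B) \<and>
        ((a, b, c, d) \<in> tile_class T I0 J1 \<longrightarrow> v a + h b - v c - h d = C) \<and>
        ((a, b, c, d) \<in> tile_class T I1 J1 \<longrightarrow> v a + h b - v c - h d = D)"
    using assms(3) unfolding determines_quadrilateral_def by blast
  \<comment> \<open>Matching identifies the east label at a point with the west label of its right
    neighbour, and north with south one step up. With these potentials the vector of each tile
    becomes a discrete divergence.\<close>
  define f where "f n = v (west (w n))" for n
  define g where "g n = h (south (w n))" for n
  have fg: "f (x + 1, y) = v (east (w (x, y)))" "g (x, y + 1) = h (north (w (x, y)))" for x y
    using assms(4) by (simp_all add: valid_configuration_def f_def g_def)
  have F: "(f (x + 1, y) - f (x, y)) + (g (x, y + 1) - g (x, y))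
      = (if c x then if r y then D else C else if r y then B else A)" for x y
  proof -
    obtain a b a' b' where t: "w (x, y) = (a, b, a', b')"
      by (metis prod.exhaust)
    have "(f (x + 1, y) - f (x, y)) + (g (x, y + 1) - g (x, y)) = v a + h b - v a' - h b'"
      unfolding fg by (simp add: f_def g_def t)
    with cls[of x y] vh T[of "(x, y)"] show ?thesis
      unfolding t by auto
  qed
  have fin: "finite T"
    using assms(1) by (simp add: wang_tiles_def)
  \<comment> \<open>Only the values of \<open>u\<close> on the finite set \<open>T\<close>
    occur.\<close>
  have bounded: "\<exists>N. \<forall>n. norm (u (w n)) \<le> N" for u :: "('i, 'j) tile \<Rightarrow> real ^ 2"
    using finite_imp_bounded[OF finite_imageI[OF fin, of u]] T unfolding bounded_iff by blast
  obtain M where M: "norm (f n) \<le> M" for n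
    using bounded[of "v \<circ> west"] by (auto simp: f_def)
  obtain N where N: "norm (g n) \<le> N" for n
    using bounded[of "h \<circ> south"] by (auto simp: g_def)
  define S where "S K = (\<Sum>x\<in>{- int K..int K}. \<Sum>y\<in>{- int K..int K}.
      (f (x + 1, y) - f (x, y)) + (g (x, y + 1) - g (x, y)))" for K
  \<comment> \<open>\<open>p K\<close> is the sum over a column without a vertical stripe,
    \<open>q K\<close> over a column with one.\<close>
  define p where "p K = (?M K - ?b K) *\<^sub>R A + ?b K *\<^sub>R B" for K
  define q where "q K = (?M K - ?b K) *\<^sub>R C + ?b K *\<^sub>R D" for K
  have S: "S K = (?M K - ?a K) *\<^sub>R p K + ?a K *\<^sub>R q K" for K
  proof -
    have "S K = (\<Sum>x\<in>{- int K..int K}. if c x then q K else p K)"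
      unfolding S_def F by (intro sum.cong refl) (simp add: sum_If_scaleR p_def q_def add.commute)
    then show ?thesis
      by (simp add: sum_If_scaleR add.commute)
  qed
  have "(1 / (?M K)\<^sup>2) *\<^sub>R S K
      = (1 - ?a K / ?M K) *\<^sub>R ((1 - ?b K / ?M K) *\<^sub>R A + (?b K / ?M K) *\<^sub>R B)
      + (?a K / ?M K) *\<^sub>R ((1 - ?b K / ?M K) *\<^sub>R C + (?b K / ?M K) *\<^sub>R D)" for K
  proof -
    \<comment> \<open>One factor \<open>1 / ?M K\<close> goes to the column count and one to the row
      count. The differences \<open>?M K - z\<close> stay unexpanded, so reordering scalar factors
      suffices. \<open>quot\<close> is instantiated below because its general form would also
      rewrite \<open>1 / ?M K\<close> and loop.\<close>
    have diff: "1 - z / ?M K = (1 / ?M K) * (?M K - z)" for z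
      by (simp add: diff_divide_distrib)
    have quot: "z / ?M K = (1 / ?M K) * z" for z
      by simp
    have square: "1 / (?M K)\<^sup>2 = (1 / ?M K) * (1 / ?M K)"
      by (simp add: power2_eq_square)
    show ?thesis
      unfolding S p_def q_def square diff unfolding quot[of "?a K"] quot[of "?b K"]
      by (simp only: scaleR_add_right scaleR_scaleR mult.assoc mult.commute mult.left_commute)
  qed
  then have lim: "(\<lambda>K. (1 / (?M K)\<^sup>2) *\<^sub>R S K) \<longlonglongrightarrow>
      (1 - \<alpha>) *\<^sub>R ((1 - \<beta>) *\<^sub>R A + \<beta> *\<^sub>R B) + \<alpha> *\<^sub>R ((1 - \<beta>) *\<^sub>R C + \<beta> *\<^sub>R D)"
    using \<alpha> \<beta> by (simp only:) (intro tendsto_intros)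
  \<comment> \<open>The boundary term, linear in \<open>K\<close>, is divided by the quadratic
    area.\<close>
  have bound: "norm ((1 / (?M K)\<^sup>2) *\<^sub>R S K) \<le> (2 * M + 2 * N) / ?M K" for K
  proof -
    have "norm ((1 / (?M K)\<^sup>2) *\<^sub>R S K) = norm (S K) / (?M K)\<^sup>2"
      by simp
    also have "\<dots> \<le> ?M K * (2 * M + 2 * N) / (?M K)\<^sup>2"
      using norm_sum_discrete_divergence_le[OF M N] unfolding S_def
      by (intro divide_right_mono) auto
    also have "\<dots> = (2 * M + 2 * N) / ?M K"
      by (simp add: power2_eq_square)
    finally show ?thesis .
  qed
  have "(\<lambda>K. (2 * M + 2 * N) / ?M K) \<longlonglongrightarrow> 0"
    by real_asymp
  then have "(\<lambda>K. (1 / (?M K)\<^sup>2) *\<^sub>R S K) \<longlonglongrightarrow> 0"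
    by (rule Lim_null_comparison[OF always_eventually[OF allI[OF bound]]])
  then show ?thesis
    using lim LIMSEQ_unique by blast
qed

end
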